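(* Let $n\ge 1$ be an integer, let $p(t)=\sum_{k=0}^n a_k t^k$ be a polynomial with complex coefficients such that $a_0\neq 0$ and $a_n\ne 0$, and let $F(x)=p(\mathrm{E})\,(x+n)_{n+1}$. Suppose that $$\frac{a_1}{a_0}=\frac{a_{n-1}}{a_n}\qquad\text{and}\qquad k\,a_k+(n-k+2)\,a_{k-2}=\frac{a_1}{a_0}\,a_{k-1}\quad\text{for all } 2\le k\le n.$$ Then $$\left(n+2+\frac{a_1}{a_0}\right)F(x)=x\bigl(F(x+1)-F(x-1)\bigr).$$ Moreover, if $b_k=[x^k]\,p(\mathrm{E})\,(x+n)_{n+1}$ denotes the coefficient of $x^k$ in $F(x)$, then for every integer $k\ge 0$, $$\left(\frac{n+2+\frac{a_1}{a_0}}{2}-k\right)b_k=\sum_{j\ge 1}\binom{k+2j}{2j+1}\,b_{k+2j}.$$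
   Context: $\mathrm{E}$ is the backward shift operator on polynomials, $(\mathrm{E}f)(x)=f(x-1)$, so $p(\mathrm{E})f(x)=\sum_{k=0}^n a_k f(x-k)$. $(a)_m=a(a-1)\cdots(a-m+1)$ is the falling factorial. *)

theory Defs
  imports Complex_Main "HOL-Computational_Algebra.Polynomial"
begin

definition falling :: "'a :: comm_ring_1 \<Rightarrow> nat \<Rightarrow> 'a" where
  "falling a m = (\<Prod>i<m. a - of_nat i)"

definition bshift :: "'a :: comm_ring_1 poly \<Rightarrow> 'a poly" where
  "bshift f = f \<circ>\<^sub>p [:-1, 1:]"

text \<open>The operator \<open>p(T)\<close>, for an operator \<open>T\<close> on polynomials.\<close>

definition poly_op :: "'a :: comm_ring_1 poly \<Rightarrow> ('a poly \<Rightarrow> 'a poly) \<Rightarrow> 'a poly \<Rightarrow> 'a poly" where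
  "poly_op p T f = (\<Sum>k\<le>degree p. smult (coeff p k) ((T ^^ k) f))"

lemma poly_bshift: "poly (bshift f) x = poly f (x - 1)"
  by (simp add: bshift_def poly_pcompose)

lemma poly_poly_op_bshift:
  "poly (poly_op p bshift f) x = (\<Sum>k\<le>degree p. coeff p k * poly f (x - of_nat k))"
proof -
  have "poly ((bshift ^^ k) f) x = poly f (x - of_nat k)" for k
    by (induction k arbitrary: x) (simp_all add: poly_bshift algebra_simps)
  then show ?thesis
    by (simp add: poly_op_def poly_sum)
qed

end

theory Submission
  imports Defs
begin

text \<open>Write \<open>G\<close> for the rising product \<open>y (y + 1) \<dots> (y + n)\<close> and \<open>r = a\<^sub>1 / a\<^sub>0\<close>. With \<open>a\<^sub>k\<close> extended by zero outside
  \<open>0 \<le> k \<le> n\<close>, the hypotheses say that \<open>r a\<^sub>k = (k + 1) a\<^bsub>k+1\<^esub> + (n - k + 1) a\<^bsub>k-1\<^esub>\<close> for every \<open>k\<close>.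
  Inserting this into \<open>r F(x) = \<Sum> r a\<^sub>k G(x - k)\<close> and shifting the index, the functional equation holds
  summand by summand because \<open>(n + 2) G(y) = y G(y + 1) - (y + n) G(y - 1)\<close>. Comparing the
  coefficients of \<open>x\<^sup>k\<close> on both sides gives the identity for the \<open>b\<^sub>k\<close>.\<close>

lemma poly_falling: "poly (falling q m) x = falling (poly q x) m"
  by (simp add: falling_def poly_prod)

lemma falling_Suc: "falling a (Suc m) = falling a m * (a - of_nat m)"
  by (simp add: falling_def)

lemma falling_Suc_shift: "falling a (Suc m) = a * falling (a - 1) m"
  by (induction m) (simp_all add: falling_def algebra_simps)

text \<open>Each shifted product differs from \<open>falling (y + of_nat n) (n + 1)\<close> in one
  factor at an end. Multiplied by \<open>y\<close> and \<open>y + of_nat n\<close>, the two become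
  its multiples by \<open>y + 1 + n\<close> and \<open>y - 1\<close>, which differ by
  \<open>n + 2\<close>.\<close>

lemma falling_three_term:
  fixes y :: "'a :: comm_ring_1"
  shows "of_nat (n + 2) * falling (y + of_nat n) (n + 1) =
    y * falling (y + 1 + of_nat n) (n + 1) - (y + of_nat n) * falling (y - 1 + of_nat n) (n + 1)"
proof -
  have up: "y * falling (y + 1 + of_nat n) (n + 1) =
      (y + 1 + of_nat n) * falling (y + of_nat n) (n + 1)"
  proof -
    have "falling (y + 1 + of_nat n) (Suc n) = (y + 1 + of_nat n) * falling (y + of_nat n) n"
      by (subst falling_Suc_shift) (simp add: algebra_simps)
    moreover have "falling (y + of_nat n) (Suc n) = falling (y + of_nat n) n * y"
      by (simp add: falling_Suc)
    ultimately show ?thesis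
      by (simp add: mult_ac)
  qed
  have down: "(y + of_nat n) * falling (y - 1 + of_nat n) (n + 1) =
      (y - 1) * falling (y + of_nat n) (n + 1)"
  proof -
    have "falling (y - 1 + of_nat n) (Suc n) = falling (y - 1 + of_nat n) n * (y - 1)"
      by (simp add: falling_Suc)
    moreover have "falling (y + of_nat n) (Suc n) = (y + of_nat n) * falling (y - 1 + of_nat n) n"
      by (subst falling_Suc_shift) (simp add: algebra_simps)
    ultimately show ?thesis
      by (simp add: mult_ac)
  qed
  show ?thesis
    unfolding up down by (simp add: algebra_simps)
qed

text \<open>The hypotheses are free of division, so any commutative ring will do. For
  \<open>k = n - 1\<close>, \<open>rec\<close> and \<open>c0\<close> together give the boundary
  condition \<open>r * c n = c (n - 1)\<close>.\<close>

lemma functional_equation: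
  fixes c :: "nat \<Rightarrow> 'a :: comm_ring_1" and r x :: 'a and f :: "'a \<Rightarrow> 'a"
  assumes f: "\<And>y. f y = (\<Sum>k\<le>n. c k * falling (y - of_nat k + of_nat n) (n + 1))"
    and rec0: "r * c 0 = c 1"
    and rec: "\<And>k. k < n \<Longrightarrow> r * c (Suc k) = of_nat (k + 2) * c (k + 2) + of_nat (n - k) * c k"
    and c0: "c (Suc n) = 0"
  shows "(of_nat n + 2 + r) * f x = x * (f (x + 1) - f (x - 1))"
proof -
  define g where "g y = falling (y + of_nat n) (n + 1)" for y :: 'a
  \<comment> \<open>The recurrence splits \<open>r * c k * g (x - k)\<close> into
    \<open>u (Suc k)\<close>, which carries \<open>c (k + 1)\<close>, and \<open>v k\<close>, which
    carries \<open>c (k - 1)\<close>. After the index shifts, \<open>u k\<close> and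
    \<open>v (Suc k)\<close> both carry \<open>c k\<close>.\<close>
  define u where "u k = of_nat k * c k * g (x - of_nat k + 1)" for k
  define v where "v k = (case k of 0 \<Rightarrow> 0 | Suc i \<Rightarrow> of_nat (n - i) * c i * g (x - of_nat k))" for k
  have f_g: "f y = (\<Sum>k\<le>n. c k * g (y - of_nat k))" for y
    by (simp add: f g_def)
  have g: "(of_nat n + 2) * g y = y * g (y + 1) - (y + of_nat n) * g (y - 1)" for y
    using falling_three_term[of n y] by (simp add: g_def add_ac)
  have "r * (c k * g (x - of_nat k)) = u (Suc k) + v k" if "k \<le> n" for k
  proof (cases k)
    case 0
    then show ?thesis
      using rec0 by (simp add: u_def v_def flip: mult.assoc)
  next
    case (Suc i)
    then have "r * c k = of_nat (i + 2) * c (i + 2) + of_nat (n - i) * c i"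
      using rec[of i] that by simp
    then have "r * (c k * g (x - of_nat k)) =
        (of_nat (i + 2) * c (i + 2) + of_nat (n - i) * c i) * g (x - of_nat k)"
      by (simp flip: mult.assoc)
    moreover have "x - of_nat (Suc k) + 1 = x - of_nat k"
      by simp
    ultimately show ?thesis
      unfolding u_def v_def using Suc by (simp add: algebra_simps)
  qed
  then have "r * f x = (\<Sum>k\<le>n. u (Suc k)) + (\<Sum>k\<le>n. v k)"
    by (simp add: f_g sum_distrib_left sum.distrib)
  \<comment> \<open>Both shifts cost nothing: \<open>u 0\<close> and \<open>v (Suc n)\<close> have
    the factors 0 and \<open>n - n\<close>, \<open>u (Suc n)\<close> contains
    \<open>c (Suc n) = 0\<close>, and \<open>v 0 = 0\<close> by definition.\<close>
  also have "(\<Sum>k\<le>n. u (Suc k)) = (\<Sum>k\<le>n. u k)"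
    using sum.atMost_Suc_shift[of u n] by (simp add: u_def c0)
  also have "(\<Sum>k\<le>n. v k) = (\<Sum>k\<le>n. v (Suc k))"
    using sum.atMost_Suc_shift[of v n] by (simp add: v_def)
  finally have "(of_nat n + 2 + r) * f x =
      (\<Sum>k\<le>n. c k * ((of_nat n + 2) * g (x - of_nat k)) + u k + v (Suc k))"
    by (simp add: f_g sum_distrib_left sum.distrib algebra_simps)
  \<comment> \<open>With \<open>y = x - k\<close>, the factor of \<open>g (y + 1)\<close> is
    \<open>y + k = x\<close>, and that of \<open>g (y - 1)\<close> is
    \<open>-(y + n) + (n - k) = -x\<close>.\<close>
  also have "\<dots> = (\<Sum>k\<le>n. x * (c k * g (x + 1 - of_nat k) - c k * g (x - 1 - of_nat k)))"
  proof (intro sum.cong refl)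
    fix k assume "k \<in> {..n}"
    then have "(of_nat (n - k) :: 'a) = of_nat n - of_nat k"
      by (simp add: of_nat_diff)
    moreover have "x - of_nat k + 1 = x + 1 - of_nat k" "x - of_nat k - 1 = x - 1 - of_nat k"
      "x - of_nat (Suc k) = x - 1 - of_nat k"
      by simp_all
    ultimately show "c k * ((of_nat n + 2) * g (x - of_nat k)) + u k + v (Suc k) =
        x * (c k * g (x + 1 - of_nat k) - c k * g (x - 1 - of_nat k))"
      unfolding u_def v_def g nat.case by (simp only:) (simp add: algebra_simps)
  qed
  also have "\<dots> = x * (f (x + 1) - f (x - 1))"
    by (simp only: f_g sum_distrib_left[symmetric] sum_subtractf)
  finally show ?thesis .
qed

lemma pcompose_power: "(q ^ k) \<circ>\<^sub>p h = (q \<circ>\<^sub>p h) ^ k"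
  for q h :: "'a :: comm_semiring_1 poly"
  by (induction k) (simp_all add: pcompose_1 pcompose_mult)

text \<open>Binomial expansion of each power of \<open>x + c\<close>. For \<open>i < m\<close> the
  truncated exponent \<open>i - m\<close> is harmless, as the binomial coefficient vanishes.\<close>

lemma coeff_pcompose_shift:
  fixes q :: "'a :: comm_ring_1 poly"
  shows "coeff (q \<circ>\<^sub>p [:c, 1:]) m = (\<Sum>i\<le>degree q. coeff q i * (of_nat (i choose m) * c ^ (i - m)))"
proof -
  have "q \<circ>\<^sub>p [:c, 1:] = (\<Sum>i\<le>degree q. smult (coeff q i) ([:c, 1:] ^ i))"
    by (subst poly_as_sum_of_monoms[of q, symmetric])
       (simp add: pcompose_sum monom_altdef pcompose_smult pcompose_power pcompose_pCons)
  moreover have "coeff ([:c, 1:] ^ i) m = of_nat (i choose m) * c ^ (i - m)" for i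
    by (cases "m \<le> i")
       (simp_all add: coeff_linear_poly_power coeff_eq_0 binomial_eq_0 degree_linear_power)
  ultimately show ?thesis
    by (simp add: coeff_sum)
qed

text \<open>The factor \<open>1 - (-1) ^ (i - m)\<close> kills even offsets \<open>i - m\<close> and
  is 2 on odd ones, whence \<open>i = m + 2 * j + 1\<close>.\<close>

lemma coeff_central_difference:
  fixes q :: "'a :: comm_ring_1 poly"
  shows "coeff (q \<circ>\<^sub>p [:1, 1:] - q \<circ>\<^sub>p [:-1, 1:]) m =
    2 * (\<Sum>j | m + 2 * j + 1 \<le> degree q.
      of_nat ((m + 2 * j + 1) choose (2 * j + 1)) * coeff q (m + 2 * j + 1))"
proof -
  let ?t = "\<lambda>i. coeff q i * (of_nat (i choose m) * (1 - (-1) ^ (i - m)))"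
  have "coeff (q \<circ>\<^sub>p [:1, 1:] - q \<circ>\<^sub>p [:-1, 1:]) m = sum ?t {..degree q}"
    by (simp add: coeff_pcompose_shift algebra_simps flip: sum_subtractf)
  also have "\<dots> = sum ?t ((\<lambda>j. m + 2 * j + 1) ` {j. m + 2 * j + 1 \<le> degree q})"
  proof (intro sum.mono_neutral_right)
    show "\<forall>i\<in>{..degree q} - (\<lambda>j. m + 2 * j + 1) ` {j. m + 2 * j + 1 \<le> degree q}. ?t i = 0"
    proof
      fix i assume i: "i \<in> {..degree q} - (\<lambda>j. m + 2 * j + 1) ` {j. m + 2 * j + 1 \<le> degree q}"
      show "?t i = 0"
      proof (cases "m \<le> i \<and> odd (i - m)")
        case True
        then obtain j where "i - m = 2 * j + 1"
          by (elim conjE oddE)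
        then have "i = m + 2 * j + 1"
          using True by linarith
        then show ?thesis
          using i by blast
      qed (auto simp: binomial_eq_0)
    qed
  qed auto
  also have "\<dots> = (\<Sum>j | m + 2 * j + 1 \<le> degree q. ?t (m + 2 * j + 1))"
    by (subst sum.reindex) (auto simp: inj_on_def)
  also have "\<dots> = (\<Sum>j | m + 2 * j + 1 \<le> degree q.
      2 * (of_nat ((m + 2 * j + 1) choose (2 * j + 1)) * coeff q (m + 2 * j + 1)))"
  proof (intro sum.cong refl)
    fix j
    have "(m + 2 * j + 1) choose m = (m + 2 * j + 1) choose (2 * j + 1)"
      by (subst binomial_symmetric) simp_all
    then show "?t (m + 2 * j + 1) =
        2 * (of_nat ((m + 2 * j + 1) choose (2 * j + 1)) * coeff q (m + 2 * j + 1))"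
      by (simp del: binomial_Suc_Suc)
  qed
  finally show ?thesis
    by (simp add: sum_distrib_left)
qed

text \<open>The factor \<open>x\<close> raises the index by one, so odd offsets from
  \<open>k - 1\<close> become even offsets \<open>2 * j\<close> from \<open>k\<close>. The term
  \<open>j = 0\<close> is \<open>k * coeff q k\<close>, which goes to the left after
  halving.\<close>

lemma coeff_identity_of_functional_equation:
  fixes q :: "'a :: field_char_0 poly"
  assumes "\<And>x. s * poly q x = x * (poly q (x + 1) - poly q (x - 1))"
  shows "(s / 2 - of_nat k) * coeff q k =
    (\<Sum>j | 1 \<le> j \<and> k + 2 * j \<le> degree q.
      of_nat ((k + 2 * j) choose (2 * j + 1)) * coeff q (k + 2 * j))"
proof -
  \<comment> \<open>Over an infinite field, equality of values gives equality of
    polynomials.\<close>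
  have "smult s q = pCons 0 (q \<circ>\<^sub>p [:1, 1:] - q \<circ>\<^sub>p [:-1, 1:])"
    using assms by (intro poly_ext) (simp add: poly_pcompose add_ac)
  then have coeff: "s * coeff q k = coeff (pCons 0 (q \<circ>\<^sub>p [:1, 1:] - q \<circ>\<^sub>p [:-1, 1:])) k"
    by (metis coeff_smult)
  show ?thesis
  proof (cases k)
    case 0
    \<comment> \<open>Both sides vanish: the right side of \<open>coeff\<close> has no constant
      term, and \<open>2 * j choose (2 * j + 1)\<close> is 0.\<close>
    then show ?thesis
      using coeff by (simp add: binomial_eq_0)
  next
    case (Suc m)
    let ?t = "\<lambda>j. of_nat ((k + 2 * j) choose (2 * j + 1)) * coeff q (k + 2 * j)"
    have "s * coeff q k = 2 * (\<Sum>j | k + 2 * j \<le> degree q. ?t j)"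
      using coeff Suc by (simp only: coeff_pCons_Suc coeff_central_difference) simp
    moreover have "(\<Sum>j | k + 2 * j \<le> degree q. ?t j) =
        of_nat k * coeff q k + (\<Sum>j | 1 \<le> j \<and> k + 2 * j \<le> degree q. ?t j)"
    proof (cases "k \<le> degree q")
      case True
      then have "{j. k + 2 * j \<le> degree q} = insert 0 {j. 1 \<le> j \<and> k + 2 * j \<le> degree q}"
        by (auto intro: Suc_leI)
      moreover have "finite {j. 1 \<le> j \<and> k + 2 * j \<le> degree q}"
        by (rule finite_subset[of _ "{..degree q}"]) auto
      ultimately show ?thesis
        by simp
    next
      \<comment> \<open>No term \<open>j = 0\<close> is present to split off, but
        \<open>coeff q k\<close> is then 0.\<close>
      case False
      then have "{j. k + 2 * j \<le> degree q} = {}" "{j. 1 \<le> j \<and> k + 2 * j \<le> degree q} = {}"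
        by auto
      then show ?thesis
        using False by (simp only:) (simp add: coeff_eq_0)
    qed
    ultimately show ?thesis
      by (simp add: field_simps)
  qed
qed

theorem theorem3p1:
  fixes n :: nat and a :: "nat \<Rightarrow> complex" and p F :: "complex poly"
  assumes "n \<ge> 1"
    and "p = (\<Sum>k\<le>n. monom (a k) k)"
    and "a 0 \<noteq> 0" and "a n \<noteq> 0"
    and "F = poly_op p bshift (falling [:of_nat n, 1:] (n + 1))"
    and "a 1 / a 0 = a (n - 1) / a n"
    and "\<forall>k. 2 \<le> k \<and> k \<le> n \<longrightarrow>
           of_nat k * a k + of_nat (n - k + 2) * a (k - 2) = a 1 / a 0 * a (k - 1)"
  shows "(\<forall>x. (of_nat n + 2 + a 1 / a 0) * poly F x = x * (poly F (x + 1) - poly F (x - 1))) \<and>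
         (\<forall>k. ((of_nat n + 2 + a 1 / a 0) / 2 - of_nat k) * coeff F k =
           (\<Sum>j | 1 \<le> j \<and> k + 2 * j \<le> degree F.
              of_nat ((k + 2 * j) choose (2 * j + 1)) * coeff F (k + 2 * j)))"
proof -
  have coeff_p: "coeff p k = (if k \<le> n then a k else 0)" for k
    using assms(2) by (simp add: coeff_sum)
  have "degree p \<le> n"
    by (rule degree_le) (simp add: coeff_p)
  moreover have "n \<le> degree p"
    by (rule le_degree) (simp add: coeff_p assms(4))
  ultimately have degree_p: "degree p = n"
    by simp
  have FE: "(of_nat n + 2 + a 1 / a 0) * poly F x = x * (poly F (x + 1) - poly F (x - 1))" for x
  \<comment> \<open>\<open>coeff p\<close> rather than \<open>a\<close>, since \<open>a\<close> is
    arbitrary beyond \<open>n\<close> while the recurrence needs zero at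
    \<open>Suc n\<close>.\<close>
  proof (rule functional_equation[where c = "coeff p"])
    show "poly F y = (\<Sum>k\<le>n. coeff p k * falling (y - of_nat k + of_nat n) (n + 1))" for y
      by (simp add: assms(5) poly_poly_op_bshift degree_p poly_falling add_ac)
    show "a 1 / a 0 * coeff p 0 = coeff p 1"
      using assms(1,3) by (simp add: coeff_p)
    show "a 1 / a 0 * coeff p (Suc k) = of_nat (k + 2) * coeff p (k + 2) + of_nat (n - k) * coeff p k"
      if "k < n" for k
    proof (cases "k + 2 \<le> n")
      case True
      then have "n - (k + 2) + 2 = n - k"
        by simp
      then show ?thesis
        using True assms(7)[rule_format, of "k + 2"] by (simp add: coeff_p)
    next
      \<comment> \<open>At the top index \<open>coeff p (k + 2) = 0\<close> and
        \<open>n - k = 1\<close>, so the claim is the condition on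
        \<open>a (n - 1) / a n\<close>.\<close>
      case False
      then have "n = Suc k"
        using that by simp
      then show ?thesis
        using assms(4,6) by (simp add: coeff_p)
    qed
    show "coeff p (Suc n) = 0"
      by (simp add: coeff_p)
  qed
  with coeff_identity_of_functional_equation[of _ F] show ?thesis
    by blast
qed

end
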